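(* Let $\mathbf{w}^t$ and $\theta^t_1,\ldots,\theta^t_K$ be the parameters at the beginning of round $t$ of the algorithm DFORD-Linear, and let $\eta_t=\frac{1}{\lambda t}$. For every round $t\ge 2$: if $$\mathbb{E}[\theta^t_{i+1}-\theta^t_i]\ge\frac{K\eta_t}{1-\eta_t\lambda}\quad\text{for all } i\in[K-1],$$ then $$\mathbb{E}[\theta^{t+1}_{i+1}-\theta^{t+1}_i]\ge 0\quad\text{for all } i\in[K-1].$$
   Context: $[K]=\{1,\ldots,K\}$ is the ordered label set, $K$ is a positive integer, $\lambda>0$ and $\gamma\in(0,1]$ are parameters, and $(\mathbf{x}^t,y^t)$, $\mathbf{x}^t\in\mathbb{R}^d$, $y^t\in[K]$, is a fixed (non-random) sequence of examples. Thresholds $\theta_1,\ldots,\theta_{K-1}$ are real, and by convention $\theta_K=+\infty$ always (never updated; $0\cdot\infty=0$), so differences involving $\theta_K$ equal $+\infty$. Algorithm DFORD-Linear. Start with $\mathbf{w}^2=\mathbf{0}$, $\theta_1^2=\cdots=\theta_{K-1}^2=0$. In round $t=2,3,\ldots,T$: 1. $\hat y^t=\min\{i\in[K]:\mathbf{w}^t\cdot\mathbf{x}^t-\theta^t_i\le 0\}$. 2. Let $P^t=(1-\gamma)P_1^t+\gamma P_2^t$ on $[K]$, where $P_1^t(i)=\mathbb{I}[i=\hat y^t]$ and $P_2^t(i)=\dfrac{1+d_{\max}^t-|i-\hat y^t|}{Z^t}$ with $d_{\max}^t=\max\{\hat y^t,K-\hat y^t\}$ and $Z^t=\sum_{i=1}^K(1+d_{\max}^t-|i-\hat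 y^t|)$. 3. Sample $\tilde y^t\sim P^t$ (conditionally on the past) and observe $d_t=\mathbb{I}[\tilde y^t<y^t]$. 4. Set $\tilde z_i^t=\dfrac{(2d_t-1)\mathbb{I}[i=\tilde y^t]}{P^t(i)}$ and $\tilde\tau_i^t=\tilde z_i^t\,\mathbb{I}[\tilde z_i^t(\mathbf{w}^t\cdot\mathbf{x}^t-\theta_i^t)\le 0]$, $i\in[K]$ (so $\tilde\tau^t_i=0$ for $i\neq\tilde y^t$, and $\tilde\tau_K^t=0$). 5. With $\eta_t=\frac{1}{\lambda t}$, update $\mathbf{w}^{t+1}=(1-\eta_t\lambda)\mathbf{w}^t+\eta_t\tilde\tau^t_{\tilde y^t}\mathbf{x}^t$ and $\theta_i^{t+1}=(1-\eta_t\lambda)\theta_i^t-\mathbb{I}[i=\tilde y^t]\eta_t\tilde\tau^t_{\tilde y^t}$ for $i\in[K-1]$. $\mathbb{E}$ denotes expectation over all labels $\tilde y^s$ sampled by the algorithm. *)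

theory Defs
  imports "HOL-Probability.Probability"
begin

(* Only the values \<theta> 1, ..., \<theta> (K - 1) of the real-valued \<theta> are meaningful; the K-th threshold
   is the constant \<infinity>.  In ereal, 0 * \<infinity> = 0. *)
definition threshold :: "nat \<Rightarrow> (nat \<Rightarrow> real) \<Rightarrow> nat \<Rightarrow> ereal" where
  "threshold K \<theta> i = (if i = K then \<infinity> else ereal (\<theta> i))"

(* The argument s is the score w \<bullet> x. *)
definition predicted_label :: "nat \<Rightarrow> real \<Rightarrow> (nat \<Rightarrow> real) \<Rightarrow> nat" where
  "predicted_label K s \<theta> = Min {i \<in> {1..K}. ereal s - threshold K \<theta> i \<le> 0}"

definition d_max :: "nat \<Rightarrow> nat \<Rightarrow> real" where
  "d_max K yhat = max (real yhat) (real K - real yhat)"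

definition explore_weight :: "nat \<Rightarrow> nat \<Rightarrow> nat \<Rightarrow> real" where
  "explore_weight K yhat i = 1 + d_max K yhat - \<bar>real i - real yhat\<bar>"

definition label_prob :: "nat \<Rightarrow> real \<Rightarrow> nat \<Rightarrow> nat \<Rightarrow> real" where
  "label_prob K \<gamma> yhat i =
     (1 - \<gamma>) * of_bool (i = yhat)
     + \<gamma> * (explore_weight K yhat i / (\<Sum>j = 1..K. explore_weight K yhat j))"

definition label_pmf :: "nat \<Rightarrow> real \<Rightarrow> nat \<Rightarrow> nat pmf" where
  "label_pmf K \<gamma> yhat = embed_pmf (\<lambda>i. if i \<in> {1..K} then label_prob K \<gamma> yhat i else 0)"

definition z_est :: "nat \<Rightarrow> real \<Rightarrow> nat \<Rightarrow> nat \<Rightarrow> nat \<Rightarrow> nat \<Rightarrow> real" where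
  "z_est K \<gamma> yhat y ytil i =
     (2 * of_bool (ytil < y) - 1) * of_bool (i = ytil) / label_prob K \<gamma> yhat i"

definition tau_est :: "nat \<Rightarrow> real \<Rightarrow> real \<Rightarrow> (nat \<Rightarrow> real) \<Rightarrow> nat \<Rightarrow> nat \<Rightarrow> nat \<Rightarrow> real" where
  "tau_est K \<gamma> s \<theta> y ytil i =
     (let z = z_est K \<gamma> (predicted_label K s \<theta>) y ytil i
      in z * of_bool (ereal z * (ereal s - threshold K \<theta> i) \<le> 0))"

definition learning_rate :: "real \<Rightarrow> nat \<Rightarrow> real" where
  "learning_rate lam t = 1 / (lam * real t)"

type_synonym 'd params = "(real ^ 'd) \<times> (nat \<Rightarrow> real)"

definition dford_update ::
  "nat \<Rightarrow> real \<Rightarrow> real \<Rightarrow> nat \<Rightarrow> real ^ 'd \<Rightarrow> nat \<Rightarrow> nat \<Rightarrow> 'd params \<Rightarrow> 'd params" where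
  "dford_update K lam \<gamma> t x y ytil = (\<lambda>(w, \<theta>).
     let \<eta> = learning_rate lam t;
         \<tau> = tau_est K \<gamma> (w \<bullet> x) \<theta> y ytil ytil
     in ((1 - \<eta> * lam) *\<^sub>R w + (\<eta> * \<tau>) *\<^sub>R x,
         \<lambda>i. (1 - \<eta> * lam) * \<theta> i - of_bool (i = ytil) * \<eta> * \<tau>))"

definition dford_round ::
  "nat \<Rightarrow> real \<Rightarrow> real \<Rightarrow> nat \<Rightarrow> real ^ 'd \<Rightarrow> nat \<Rightarrow> 'd params \<Rightarrow> 'd params pmf" where
  "dford_round K lam \<gamma> t x y p =
     map_pmf (\<lambda>ytil. dford_update K lam \<gamma> t x y ytil p)
       (label_pmf K \<gamma> (predicted_label K (fst p \<bullet> x) (snd p)))"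

(* Joint law of the parameters (w, \<theta>) at the beginning of round t, as induced by the labels sampled
   in rounds 2, ..., t - 1.  The first round is round 2; the values at 0 and 1 are fillers. *)
primrec dford_law ::
  "nat \<Rightarrow> real \<Rightarrow> real \<Rightarrow> (nat \<Rightarrow> real ^ 'd) \<Rightarrow> (nat \<Rightarrow> nat) \<Rightarrow> nat \<Rightarrow> 'd params pmf" where
  "dford_law K lam \<gamma> x y 0 = return_pmf (0, \<lambda>_. 0)"
| "dford_law K lam \<gamma> x y (Suc t) =
     (if t < 2 then return_pmf (0, \<lambda>_. 0)
      else bind_pmf (dford_law K lam \<gamma> x y t) (dford_round K lam \<gamma> t (x t) (y t)))"

(* Expectation of an extended-real random variable, as the difference of the integrals of its
   positive and negative parts (e2ennreal sends negative values to 0). *)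
definition ereal_expectation :: "'a pmf \<Rightarrow> ('a \<Rightarrow> ereal) \<Rightarrow> ereal" where
  "ereal_expectation p X =
     enn2ereal (\<integral>\<^sup>+ \<omega>. e2ennreal (X \<omega>) \<partial>measure_pmf p)
     - enn2ereal (\<integral>\<^sup>+ \<omega>. e2ennreal (- X \<omega>) \<partial>measure_pmf p)"

lemma ereal_expectation_ereal:
  fixes X :: "'a \<Rightarrow> real"
  assumes "integrable (measure_pmf p) X"
  shows "ereal_expectation p (\<lambda>\<omega>. ereal (X \<omega>)) = ereal (measure_pmf.expectation p X)"
proof -
  have fin: "(\<integral>\<^sup>+ \<omega>. ennreal (X \<omega>) \<partial>measure_pmf p) < \<top>"
    "(\<integral>\<^sup>+ \<omega>. ennreal (- X \<omega>) \<partial>measure_pmf p) < \<top>"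
    using assms by (auto simp: real_integrable_def less_top)
  show ?thesis
    using fin unfolding ereal_expectation_def real_lebesgue_integral_def[OF assms]
    by (auto simp: less_top_ennreal simp flip: ereal_minus(1) ennreal.abs_eq)
qed

lemma predicted_label_in:
  assumes "K \<ge> 1"
  shows "predicted_label K s \<theta> \<in> {1..K}"
proof -
  have "K \<in> {i \<in> {1..K}. ereal s - threshold K \<theta> i \<le> 0}"
    using assms by (simp add: threshold_def)
  then have "predicted_label K s \<theta> \<in> {i \<in> {1..K}. ereal s - threshold K \<theta> i \<le> 0}"
    unfolding predicted_label_def by (intro Min_in) auto
  then show ?thesis by blast
qed

lemma explore_weight_ge_1:
  assumes "yhat \<in> {1..K}" "i \<in> {1..K}"
  shows "explore_weight K yhat i \<ge> 1"
  using assms by (auto simp: explore_weight_def d_max_def)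

lemma pmf_label_pmf:
  assumes "0 < \<gamma>" "\<gamma> \<le> 1" and yhat: "yhat \<in> {1..K}"
  shows "pmf (label_pmf K \<gamma> yhat) i = (if i \<in> {1..K} then label_prob K \<gamma> yhat i else 0)"
proof -
  let ?Z = "\<Sum>j = 1..K. explore_weight K yhat j"
  have w: "explore_weight K yhat j > 0" if "j \<in> {1..K}" for j
    using explore_weight_ge_1[OF yhat that] by simp
  have Z: "?Z > 0" using yhat w by (intro sum_pos) auto
  have nonneg: "label_prob K \<gamma> yhat j \<ge> 0" if "j \<in> {1..K}" for j
    unfolding label_prob_def using assms w[OF that] Z by (auto intro!: add_nonneg_nonneg)
  have "(\<Sum>j = 1..K. label_prob K \<gamma> yhat j) =
        (1 - \<gamma>) * (\<Sum>j = 1..K. of_bool (j = yhat)) + \<gamma> * (?Z / ?Z)"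
    unfolding label_prob_def sum.distrib by (simp only: sum_distrib_left sum_divide_distrib)
  also have "(\<Sum>j = 1..K. of_bool (j = yhat)) = (1::real)"
    using yhat by (simp add: of_bool_def)
  finally have sum1: "(\<Sum>j = 1..K. label_prob K \<gamma> yhat j) = 1"
    using Z by simp
  have "(\<integral>\<^sup>+ j. ennreal (if j \<in> {1..K} then label_prob K \<gamma> yhat j else 0) \<partial>count_space UNIV)
      = (\<Sum>j = 1..K. ennreal (label_prob K \<gamma> yhat j))"
    by (subst nn_integral_count_space'[where A = "{1..K}"]) (auto intro!: sum.cong)
  also have "\<dots> = 1"
    using nonneg sum1 by (subst sum_ennreal) auto
  finally show ?thesis
    unfolding label_pmf_def using nonneg by (subst pmf_embed_pmf) auto
qed

lemma finite_set_dford_law: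
  assumes "K \<ge> 1" "0 < \<gamma>" "\<gamma> \<le> 1"
  shows "finite (set_pmf (dford_law K lam \<gamma> x y t))"
proof (induction t)
  case (Suc t)
  have "set_pmf (label_pmf K \<gamma> (predicted_label K s \<theta>)) \<subseteq> {1..K}" for s \<theta>
    using pmf_label_pmf[OF assms(2,3) predicted_label_in[OF assms(1)]]
    by (auto simp: set_pmf_iff split: if_splits)
  then have "finite (set_pmf (label_pmf K \<gamma> (predicted_label K s \<theta>)))" for s \<theta>
    by (rule finite_subset) simp
  with Suc show ?case by (auto simp: dford_round_def)
qed auto

end

theory Submission
  imports Defs
begin

text \<open>
  Importance weighting makes the sampled step unbiased: given the past, the \<open>i\<close>-th threshold moves on
  average from \<open>\<theta> i\<close> to \<open>(1 - \<eta> * lam) * \<theta> i - \<eta> * c\<close> with \<open>\<bar>c\<bar> \<le> 1\<close>, because the factor \<open>P(i)\<close>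
  cancels the weight \<open>1 / P(i)\<close>.  Hence the expected gap of two neighbouring finite thresholds is at
  least \<open>(1 - \<eta> * lam)\<close> times the old one minus \<open>2 * \<eta>\<close>, that is, at least \<open>(K - 2) * \<eta>\<close>, and
  \<open>K \<ge> 2\<close> as soon as there is a gap.  The last gap is infinite.
\<close>

lemma set_label_pmf_subset:
  assumes "0 < \<gamma>" "\<gamma> \<le> 1" "yhat \<in> {1..K}"
  shows "set_pmf (label_pmf K \<gamma> yhat) \<subseteq> {1..K}"
  using pmf_label_pmf[OF assms] by (auto simp: set_pmf_iff split: if_splits)

text \<open>Finite support makes every real function integrable, so the expectations below can be
  split linearly.\<close>

lemma finite_set_dford_round:
  assumes "K \<ge> 1" "0 < \<gamma>" "\<gamma> \<le> 1"
  shows "finite (set_pmf (dford_round K lam \<gamma> t x y p))"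
proof -
  have "finite (set_pmf (label_pmf K \<gamma> (predicted_label K (fst p \<bullet> x) (snd p))))"
    by (rule finite_subset[OF set_label_pmf_subset[OF assms(2,3) predicted_label_in[OF assms(1)]]]) simp
  then show ?thesis by (simp add: dford_round_def)
qed

text \<open>When \<open>i\<close> itself is sampled, \<open>z_est\<close> is 1 or -1 divided by
  \<open>label_prob\<close>, and the indicator keeps or kills it, so the product is 1, -1 or 0.
  Where \<open>label_prob\<close> vanishes, division by zero yields 0.\<close>

lemma abs_label_prob_tau_est_le_1:
  "\<bar>label_prob K \<gamma> (predicted_label K s \<theta>) i * tau_est K \<gamma> s \<theta> y i i\<bar> \<le> 1"
  by (simp add: tau_est_def z_est_def Let_def of_bool_def)

lemma expectation_dford_round_threshold:
  fixes w x :: "real ^ 'd" and \<theta> :: "nat \<Rightarrow> real"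
  assumes "0 < \<gamma>" "\<gamma> \<le> 1" and i: "i \<in> {1..K}"
  defines "yhat \<equiv> predicted_label K (w \<bullet> x) \<theta>"
  shows "measure_pmf.expectation (dford_round K lam \<gamma> t x y (w, \<theta>)) (\<lambda>p. snd p i)
    = (1 - learning_rate lam t * lam) * \<theta> i
      - learning_rate lam t * (label_prob K \<gamma> yhat i * tau_est K \<gamma> (w \<bullet> x) \<theta> y i i)"
proof -
  let ?\<eta> = "learning_rate lam t"
  let ?L = "label_pmf K \<gamma> yhat"
  have yhat: "yhat \<in> {1..K}"
    unfolding yhat_def using i by (intro predicted_label_in) simp
  note L = set_label_pmf_subset[OF assms(1,2) yhat]
  have fin: "finite (set_pmf ?L)"
    using L by (rule finite_subset) simp
  \<comment> \<open>This is the random part of the update of \<open>\<theta> i\<close>; the shrunken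
    old value is constant in \<open>j\<close>. Only \<open>j = i\<close> survives, with weight
    \<open>pmf ?L i\<close>, which is \<open>label_prob\<close>.\<close>
  have "measure_pmf.expectation ?L (\<lambda>j. of_bool (i = j) * ?\<eta> * tau_est K \<gamma> (w \<bullet> x) \<theta> y j j)
      = (\<Sum>j\<in>{1..K}. of_bool (i = j) * ?\<eta> * tau_est K \<gamma> (w \<bullet> x) \<theta> y j j * pmf ?L j)"
    using L by (intro integral_measure_pmf_real) auto
  also have "\<dots> = (\<Sum>j\<in>{1..K}. if i = j then ?\<eta> * tau_est K \<gamma> (w \<bullet> x) \<theta> y j j * pmf ?L j else 0)"
    by (intro sum.cong) auto
  also have "\<dots> = ?\<eta> * tau_est K \<gamma> (w \<bullet> x) \<theta> y i i * pmf ?L i"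
    using i by simp
  also have "\<dots> = ?\<eta> * (label_prob K \<gamma> yhat i * tau_est K \<gamma> (w \<bullet> x) \<theta> y i i)"
    using i pmf_label_pmf[OF assms(1,2) yhat, of i] by (simp add: mult_ac)
  finally show ?thesis
    using fin by (simp add: dford_round_def dford_update_def Let_def integrable_measure_pmf_finite
        flip: yhat_def)
qed

text \<open>The loss does not depend on \<open>p\<close>, so the bound can be integrated over the
  law of the parameters. For \<open>i + 1 = K\<close> it concerns the stored real
  \<open>\<theta> K\<close>, not the infinite threshold.\<close>

lemma expectation_dford_round_gap_ge:
  fixes p :: "'d::finite params"
  assumes "lam > 0" "0 < \<gamma>" "\<gamma> \<le> 1" and i: "i \<in> {1..K}" "i + 1 \<le> K"
  shows "measure_pmf.expectation (dford_round K lam \<gamma> t x y p) (\<lambda>p. snd p (i + 1) - snd p i)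
    \<ge> (1 - learning_rate lam t * lam) * (snd p (i + 1) - snd p i) - 2 * learning_rate lam t"
proof -
  obtain w \<theta> where p: "p = (w, \<theta>)" by (cases p)
  let ?\<eta> = "learning_rate lam t"
  let ?c = "\<lambda>i. label_prob K \<gamma> (predicted_label K (w \<bullet> x) \<theta>) i * tau_est K \<gamma> (w \<bullet> x) \<theta> y i i"
  have "finite (set_pmf (dford_round K lam \<gamma> t x y p))"
    using assms(2,3) i by (intro finite_set_dford_round) auto
  then have eq: "measure_pmf.expectation (dford_round K lam \<gamma> t x y p) (\<lambda>p. snd p (i + 1) - snd p i)
      = (1 - ?\<eta> * lam) * (\<theta> (i + 1) - \<theta> i) - ?\<eta> * (?c (i + 1) - ?c i)"
    using i
    by (simp add: p integrable_measure_pmf_finite expectation_dford_round_threshold[OF assms(2,3)]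
        right_diff_distrib)
  \<comment> \<open>Both terms lie in [-1, 1], whence the constant 2.\<close>
  have "?c (i + 1) - ?c i \<le> 2"
    using abs_label_prob_tau_est_le_1[of K \<gamma> "w \<bullet> x" \<theta> "i + 1" y]
      abs_label_prob_tau_est_le_1[of K \<gamma> "w \<bullet> x" \<theta> i y] by linarith
  moreover have "?\<eta> \<ge> 0"
    using assms(1) by (simp add: learning_rate_def)
  ultimately have "?\<eta> * (?c (i + 1) - ?c i) \<le> ?\<eta> * 2"
    by (rule mult_left_mono)
  then show ?thesis
    unfolding eq by (simp add: p)
qed

lemma expectation_dford_law_gap_ge:
  fixes x :: "nat \<Rightarrow> real ^ 'd"
  assumes "lam > 0" "0 < \<gamma>" "\<gamma> \<le> 1" "2 \<le> t" and i: "i \<in> {1..K}" "i + 1 \<le> K"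
  defines "G \<equiv> \<lambda>p :: 'd params. snd p (i + 1) - snd p i"
  shows "measure_pmf.expectation (dford_law K lam \<gamma> x y (t + 1)) G
    \<ge> (1 - learning_rate lam t * lam) * measure_pmf.expectation (dford_law K lam \<gamma> x y t) G
      - 2 * learning_rate lam t"
proof -
  let ?\<eta> = "learning_rate lam t"
  let ?M = "dford_law K lam \<gamma> x y t"
  let ?R = "dford_round K lam \<gamma> t (x t) (y t)"
  have fin: "finite (set_pmf ?M)"
    using assms by (intro finite_set_dford_law) auto
  have finR: "finite (set_pmf (?R p))" for p
    using assms(2,3) i by (intro finite_set_dford_round) auto
  have "(1 - ?\<eta> * lam) * measure_pmf.expectation ?M G - 2 * ?\<eta>
      = measure_pmf.expectation ?M (\<lambda>p. (1 - ?\<eta> * lam) * G p - 2 * ?\<eta>)"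
    using fin by (simp add: integrable_measure_pmf_finite)
  also have "\<dots> \<le> measure_pmf.expectation ?M (\<lambda>p. measure_pmf.expectation (?R p) G)"
    unfolding G_def using fin expectation_dford_round_gap_ge[OF assms(1-3) i]
    by (intro integral_mono) (auto simp: integrable_measure_pmf_finite)
  \<comment> \<open>Tower rule: with finite supports both sides are the same finite sum.\<close>
  also have "\<dots> = measure_pmf.expectation (bind_pmf ?M ?R) G"
    using fin finR by (simp add: pmf_expectation_bind[where A = "set_pmf ?M"]
        integral_measure_pmf[where A = "set_pmf ?M"])
  finally show ?thesis
    using assms(4) by simp
qed

theorem lemma1:
  fixes K T t :: nat and lam \<gamma> :: real
    and x :: "nat \<Rightarrow> real ^ 'd" and y :: "nat \<Rightarrow> nat"
  assumes "K \<ge> 1" and "lam > 0" and "0 < \<gamma>" and "\<gamma> \<le> 1"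
    and "\<forall>s\<in>{2..T}. y s \<in> {1..K}"
    and "2 \<le> t" and "t \<le> T"
    and "\<forall>i\<in>{1..K - 1}.
           ereal_expectation (dford_law K lam \<gamma> x y t)
             (\<lambda>(w, \<theta>). threshold K \<theta> (i + 1) - threshold K \<theta> i)
           \<ge> ereal (real K * learning_rate lam t / (1 - learning_rate lam t * lam))"
  shows "\<forall>i\<in>{1..K - 1}.
           ereal_expectation (dford_law K lam \<gamma> x y (t + 1))
             (\<lambda>(w, \<theta>). threshold K \<theta> (i + 1) - threshold K \<theta> i) \<ge> 0"
proof
  fix i assume i: "i \<in> {1..K - 1}"
  let ?\<eta> = "learning_rate lam t"
  let ?G = "\<lambda>p :: 'd params. snd p (i + 1) - snd p i"
  show "ereal_expectation (dford_law K lam \<gamma> x y (t + 1))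
          (\<lambda>(w, \<theta>). threshold K \<theta> (i + 1) - threshold K \<theta> i) \<ge> 0"
  proof (cases "i + 1 = K")
    case True
    then have "(\<lambda>(w :: real ^ 'd, \<theta>). threshold K \<theta> (i + 1) - threshold K \<theta> i) = (\<lambda>_. \<infinity>)"
      by (auto simp: threshold_def)
    \<comment> \<open>The positive part integrates to \<infinity> and the negative part to 0, so the
      difference is \<infinity>.\<close>
    then show ?thesis
      by (simp add: ereal_expectation_def e2ennreal_neg)
  next
    case False
    have fin: "finite (set_pmf (dford_law K lam \<gamma> x y s))" for s
      using assms(1,3,4) by (rule finite_set_dford_law)
    \<comment> \<open>Now \<open>i + 1 < K\<close>, so both thresholds are finite and the
      expectation is the ordinary one.\<close>
    have gap: "(\<lambda>(w :: real ^ 'd, \<theta>). threshold K \<theta> (i + 1) - threshold K \<theta> i)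
        = (\<lambda>p. ereal (?G p))"
      using False i by (auto simp: threshold_def)
    have expect: "ereal_expectation (dford_law K lam \<gamma> x y s)
          (\<lambda>(w, \<theta>). threshold K \<theta> (i + 1) - threshold K \<theta> i)
        = ereal (measure_pmf.expectation (dford_law K lam \<gamma> x y s) ?G)" for s
      unfolding gap using fin by (intro ereal_expectation_ereal integrable_measure_pmf_finite)
    \<comment> \<open>Here \<open>?\<eta> * lam\<close> equals \<open>1 / t\<close>, which is below
      1 because \<open>t\<close> is at least 2.\<close>
    have pos: "1 - ?\<eta> * lam > 0" and \<eta>: "?\<eta> \<ge> 0"
      using assms(2,6) by (auto simp: learning_rate_def field_simps)
    have "real K * ?\<eta> / (1 - ?\<eta> * lam) \<le> measure_pmf.expectation (dford_law K lam \<gamma> x y t) ?G"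
      using bspec[OF assms(8) i] unfolding expect by simp
    \<comment> \<open>The shrinking factor of the update cancels the denominator in the
      hypothesis.\<close>
    then have "real K * ?\<eta> \<le> (1 - ?\<eta> * lam) * measure_pmf.expectation (dford_law K lam \<gamma> x y t) ?G"
      using pos by (simp add: pos_divide_le_eq mult.commute)
    moreover have "2 * ?\<eta> \<le> real K * ?\<eta>"
      using i \<eta> by (intro mult_right_mono) auto
    moreover have "(1 - ?\<eta> * lam) * measure_pmf.expectation (dford_law K lam \<gamma> x y t) ?G - 2 * ?\<eta>
        \<le> measure_pmf.expectation (dford_law K lam \<gamma> x y (t + 1)) ?G"
      using assms(2-4,6) i by (intro expectation_dford_law_gap_ge) auto
    ultimately show ?thesis
      unfolding expect by simp
  qed
qed

end
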